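(* Let $f,g_1,\ldots,g_m,h_1,\ldots,h_l\in\mathbb{R}[\mathbf{z},\overline{\mathbf{z}}]$ be self-conjugate polynomials with real coefficients in the complex variables $\mathbf{z}=(z_1,\ldots,z_n)$ and their conjugates. For every integer $r\ge d_{\min}$, the optimal values of the complex moment relaxation, the real moment relaxation, the complex HSOS relaxation and the real HSOS relaxation (of order $r$) satisfy $$\theta_r=\eta_r\qquad\text{and}\qquad \hat{\theta}_r=\hat{\eta}_r .$$
   Context: Polynomials. For $\mathbf{z}=(z_1,\ldots,z_n)$ write elements of $\mathbb{C}[\mathbf{z},\overline{\mathbf{z}}]=\mathbb{C}[z_1,\ldots,z_n,\overline z_1,\ldots,\overline z_n]$ as finite sums $p=\sum_{(\beta,\gamma)\in\mathbb{N}^n\times\mathbb{N}^n}p_{\beta,\gamma}\mathbf{z}^{\beta}\overline{\mathbf{z}}^{\gamma}$, $p_{\beta,\gamma}\in\mathbb{C}$; $\mathbb{R}[\mathbf{z},\overline{\mathbf{z}}]$ is the subring of those with all $p_{\beta,\gamma}\in\mathbb{R}$. The conjugate of $p$ is $\overline p=\sum\overline{p_{\beta,\gamma}}\,\mathbf{z}^{\gamma}\overline{\mathbf{z}}^{\beta}$, and $p$ is self-conjugate if $\overline p=p$. For $s\in\mathbb{N}$, $\mathbb{C}_s[\mathbf{z},\overline{\mathbf{z}}]^{c}$ (resp. $\mathbb{R}_s[\mathbf{z},\overline{\mathbf{z}}]^{c}$) is the set of self-conjugate polynomials with complex (resp. real) coefficients all of whose monomials $\mathbf{z}^\beta\overline{\mathbf{z}}^\gamma$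 satisfy $|\beta|\le s$ and $|\gamma|\le s$, where $|\alpha|=\sum_i\alpha_i$. Hermitian sums of squares. $\Sigma^{\mathbb{C}}_s[\mathbf{z},\overline{\mathbf{z}}]$ is the set of self-conjugate polynomials $\sigma\in\mathbb{C}_s[\mathbf{z},\overline{\mathbf{z}}]^c$ that can be written $\sigma=|f_1|^2+\cdots+|f_t|^2$ with $f_i\in\mathbb{C}[\mathbf{z}]$ (where $|f_i|^2=f_i\overline{f_i}$); $\Sigma^{\mathbb{R}}_s[\mathbf{z},\overline{\mathbf{z}}]$ is the set of $\sigma\in\mathbb{R}_s[\mathbf{z},\overline{\mathbf{z}}]^c$ that can be written in this way with $f_i\in\mathbb{R}[\mathbf{z}]$. Degrees. $d^f=\max\{|\beta|,|\gamma|: f_{\beta,\gamma}\neq0\}$, and $d^g_i$, $d^h_i$ are defined in the same way from $g_i$, $h_i$. $d_{\min}=\max\{d^f,d^g_1,\ldots,d^g_m,d^h_1,\ldots,d^h_l\}$. Moment and localizing matrices. A pseudo-moment sequence is $\mathbf{y}=(y_{\beta,\gamma})_{(\beta,\gamma)\in\mathbb{N}^n\times\mathbb{N}^n}$ with $y_{\beta,\gamma}=\overline{y_{\gamma,\beta}}$. Put $L_{\mathbf{y}}(p)=\sum p_{\beta,\gamma}y_{\beta,\gamma}$. For $s\in\mathbb{N}$, $\mathbf{M}_s(\mathbf{y})$ is the matrix indexed by $\{\alpha\in\mathbb{N}^n:|\alpha|\le s\}$ with entries $[\mathbf{M}_s(\mathbf{y})]_{\beta\gamma}=y_{\beta,\gamma}$;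 for a polynomial $g$, $\mathbf{M}_s(g\mathbf{y})$ has the same index set and entries $[\mathbf{M}_s(g\mathbf{y})]_{\beta\gamma}=\sum_{(\beta',\gamma')}g_{\beta',\gamma'}\,y_{\beta+\beta',\gamma+\gamma'}$. $A\succeq0$ means $A$ is (Hermitian) positive semidefinite. Relaxations of order $r\ge d_{\min}$ (for the problem of minimizing $f$ subject to $g_i\ge0$, $h_i=0$ over $\mathbb{C}^n$): $\theta_r$ is the infimum of $L_{\mathbf{y}}(f)$ over complex pseudo-moment sequences $\mathbf{y}$ satisfying $\mathbf{M}_r(\mathbf{y})\succeq0$, $\mathbf{M}_{r-d^g_i}(g_i\mathbf{y})\succeq0$ for $i=1,\ldots,m$, $\mathbf{M}_{r-d^h_i}(h_i\mathbf{y})=0$ for $i=1,\ldots,l$, and $y_{\mathbf{0},\mathbf{0}}=1$. $\eta_r$ is the infimum of the same objective under the same constraints, over pseudo-moment sequences $\mathbf{y}$ with all $y_{\beta,\gamma}\in\mathbb{R}$. $\hat\theta_r$ is the supremum of $\gamma\in\mathbb{R}$ such that $f-\gamma=\sigma_0+\sum_{i=1}^m\sigma_ig_i+\sum_{i=1}^l\tau_ih_i$ for some $\sigma_0\in\Sigma^{\mathbb{C}}_r[\mathbf{z},\overline{\mathbf{z}}]$, $\sigma_i\in\Sigma^{\mathbb{C}}_{r-d^g_i}[\mathbf{z},\overline{\mathbf{z}}]$ and $\tau_i\in\mathbb{C}_{r-d^h_i}[\mathbf{z},\overline{\mathbf{z}}]^{c}$. $\hat\eta_r$ is the supremum of $\gamma\in\mathbb{R}$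 such that $f-\gamma=\sigma_0+\sum_{i=1}^m\sigma_ig_i+\sum_{i=1}^l\tau_ih_i$ for some $\sigma_0\in\Sigma^{\mathbb{R}}_r[\mathbf{z},\overline{\mathbf{z}}]$, $\sigma_i\in\Sigma^{\mathbb{R}}_{r-d^g_i}[\mathbf{z},\overline{\mathbf{z}}]$ and $\tau_i\in\mathbb{R}_{r-d^h_i}[\mathbf{z},\overline{\mathbf{z}}]^{c}$. Infima and suprema are taken in the extended reals ($\inf\emptyset=+\infty$, $\sup\emptyset=-\infty$). *)

theory Defs
  imports "HOL-Analysis.Finite_Cartesian_Product" "HOL-Library.Poly_Mapping"
    "HOL-Library.Product_Plus" "HOL-Library.Extended_Real" Complex_Main
begin

text \<open>
  The key \<open>(\<beta>, \<gamma>)\<close> of a polynomial stands for the monomial \<open>z\<^sup>\<beta> cnj(z)\<^sup>\<gamma>\<close>. Keys are added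
  componentwise, so the convolution product of \<open>Poly_Mapping\<close> is the product of
  the polynomial ring in the independent indeterminates \<open>z\<close> and \<open>cnj(z)\<close>.
\<close>

type_synonym 'n cpoly = "((nat ^ 'n) \<times> (nat ^ 'n)) \<Rightarrow>\<^sub>0 complex"

definition total_deg :: "nat ^ 'n::finite \<Rightarrow> nat" where
  "total_deg \<alpha> = (\<Sum>i\<in>UNIV. \<alpha> $ i)"

definition poly_conj :: "'n::finite cpoly \<Rightarrow> 'n cpoly" where
  "poly_conj p = (\<Sum>(\<beta>, \<gamma>)\<in>Poly_Mapping.keys p.
     Poly_Mapping.single (\<gamma>, \<beta>) (cnj (Poly_Mapping.lookup p (\<beta>, \<gamma>))))"

lemma lookup_poly_conj:
  "Poly_Mapping.lookup (poly_conj p) (\<gamma>, \<beta>) = cnj (Poly_Mapping.lookup p (\<beta>, \<gamma>))"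
proof -
  have "Poly_Mapping.lookup (poly_conj p) (\<gamma>, \<beta>) =
     (\<Sum>k\<in>Poly_Mapping.keys p. if k = (\<beta>, \<gamma>) then cnj (Poly_Mapping.lookup p k) else 0)"
    unfolding poly_conj_def lookup_sum
    by (intro sum.cong) (auto simp: lookup_single when_def split: prod.splits)
  then show ?thesis
    by (simp add: sum.delta in_keys_iff)
qed

definition self_conj :: "'n::finite cpoly \<Rightarrow> bool" where
  "self_conj p \<longleftrightarrow> poly_conj p = p"

text \<open>
  The parameter \<open>K\<close> below is the coefficient field, viewed inside the complex numbers:
  it is \<open>UNIV\<close> for the complex and \<open>\<real>\<close> for the real version of each notion.
\<close>

definition coeffs_in :: "complex set \<Rightarrow> 'n::finite cpoly \<Rightarrow> bool" where
  "coeffs_in K p \<longleftrightarrow> (\<forall>k. Poly_Mapping.lookup p k \<in> K)"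

definition self_conj_polys :: "complex set \<Rightarrow> nat \<Rightarrow> 'n::finite cpoly set" where
  "self_conj_polys K s = {p. self_conj p \<and> coeffs_in K p \<and>
     (\<forall>(\<beta>, \<gamma>)\<in>Poly_Mapping.keys p. total_deg \<beta> \<le> s \<and> total_deg \<gamma> \<le> s)}"

definition holo_polys :: "complex set \<Rightarrow> 'n::finite cpoly set" where
  "holo_polys K = {p. coeffs_in K p \<and> (\<forall>(\<beta>, \<gamma>)\<in>Poly_Mapping.keys p. \<gamma> = 0)}"

definition hsos :: "complex set \<Rightarrow> nat \<Rightarrow> 'n::finite cpoly set" where
  "hsos K s = {\<sigma> \<in> self_conj_polys K s.
     \<exists>(t::nat) q. (\<forall>i\<in>{1..t}. q i \<in> holo_polys K) \<and> \<sigma> = (\<Sum>i=1..t. q i * poly_conj (q i))}"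

text \<open>The zero polynomial, for which the maximum is over the empty set, gets degree 0.\<close>

definition poly_deg :: "'n::finite cpoly \<Rightarrow> nat" where
  "poly_deg p = Max (insert 0 (\<Union>(\<beta>, \<gamma>)\<in>Poly_Mapping.keys p. {total_deg \<beta>, total_deg \<gamma>}))"

definition d_min :: "'n::finite cpoly \<Rightarrow> nat \<Rightarrow> (nat \<Rightarrow> 'n cpoly) \<Rightarrow> nat \<Rightarrow> (nat \<Rightarrow> 'n cpoly) \<Rightarrow> nat"
  where "d_min f m g l h =
     Max ({poly_deg f} \<union> (\<lambda>i. poly_deg (g i)) ` {1..m} \<union> (\<lambda>i. poly_deg (h i)) ` {1..l})"

type_synonym 'n moment_seq = "((nat ^ 'n) \<times> (nat ^ 'n)) \<Rightarrow> complex"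

definition pseudo_moment :: "complex set \<Rightarrow> 'n::finite moment_seq \<Rightarrow> bool" where
  "pseudo_moment K y \<longleftrightarrow> (\<forall>\<beta> \<gamma>. y (\<beta>, \<gamma>) \<in> K \<and> y (\<beta>, \<gamma>) = cnj (y (\<gamma>, \<beta>)))"

definition L_fun :: "'n::finite moment_seq \<Rightarrow> 'n cpoly \<Rightarrow> complex" where
  "L_fun y p = (\<Sum>k\<in>Poly_Mapping.keys p. Poly_Mapping.lookup p k * y k)"

text \<open>
  The matrices of order \<open>s\<close> are indexed by \<open>multi_idx s\<close>. Their entries do not depend on \<open>s\<close>,
  so a matrix is an entry function together with the index set to which it is restricted.
\<close>

definition multi_idx :: "nat \<Rightarrow> (nat ^ 'n::finite) set" where
  "multi_idx s = {\<alpha>. total_deg \<alpha> \<le> s}"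

lemma finite_multi_idx: "finite (multi_idx s :: (nat ^ 'n::finite) set)"
proof -
  have "(vec_nth ` (multi_idx s :: (nat ^ 'n) set)) \<subseteq> Pi\<^sub>E UNIV (\<lambda>_. {..s})"
  proof clarify
    fix \<alpha> :: "nat ^ 'n" assume "\<alpha> \<in> multi_idx s"
    then have "\<alpha> $ i \<le> s" for i
      using member_le_sum[of i UNIV "\<lambda>i. \<alpha> $ i"] by (auto simp: multi_idx_def total_deg_def)
    then show "vec_nth \<alpha> \<in> Pi\<^sub>E UNIV (\<lambda>_. {..s})" by auto
  qed
  then have "finite (vec_nth ` (multi_idx s :: (nat ^ 'n) set))"
    by (rule finite_subset) (intro finite_PiE, auto)
  then show ?thesis by (rule finite_imageD) (auto simp: inj_on_def vec_eq_iff)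
qed

definition moment_mat :: "'n::finite moment_seq \<Rightarrow> nat ^ 'n \<Rightarrow> nat ^ 'n \<Rightarrow> complex" where
  "moment_mat y \<beta> \<gamma> = y (\<beta>, \<gamma>)"

definition localizing_mat :: "'n::finite cpoly \<Rightarrow> 'n moment_seq \<Rightarrow> nat ^ 'n \<Rightarrow> nat ^ 'n \<Rightarrow> complex"
  where "localizing_mat g y \<beta> \<gamma> =
     (\<Sum>(\<beta>', \<gamma>')\<in>Poly_Mapping.keys g. Poly_Mapping.lookup g (\<beta>', \<gamma>') * y (\<beta> + \<beta>', \<gamma> + \<gamma>'))"

definition psd_on :: "'a set \<Rightarrow> ('a \<Rightarrow> 'a \<Rightarrow> complex) \<Rightarrow> bool" where
  "psd_on I A \<longleftrightarrow> (\<forall>\<beta>\<in>I. \<forall>\<gamma>\<in>I. A \<beta> \<gamma> = cnj (A \<gamma> \<beta>)) \<and>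
     (\<forall>x. 0 \<le> Re (\<Sum>\<beta>\<in>I. \<Sum>\<gamma>\<in>I. cnj (x \<beta>) * A \<beta> \<gamma> * x \<gamma>))"

definition zero_on :: "'a set \<Rightarrow> ('a \<Rightarrow> 'a \<Rightarrow> complex) \<Rightarrow> bool" where
  "zero_on I A \<longleftrightarrow> (\<forall>\<beta>\<in>I. \<forall>\<gamma>\<in>I. A \<beta> \<gamma> = 0)"

definition moment_feasible ::
  "complex set \<Rightarrow> nat \<Rightarrow> (nat \<Rightarrow> 'n::finite cpoly) \<Rightarrow> nat \<Rightarrow> (nat \<Rightarrow> 'n cpoly) \<Rightarrow> nat
   \<Rightarrow> 'n moment_seq \<Rightarrow> bool" where
  "moment_feasible K m g l h r y \<longleftrightarrow>
     pseudo_moment K y \<and>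
     psd_on (multi_idx r) (moment_mat y) \<and>
     (\<forall>i\<in>{1..m}. psd_on (multi_idx (r - poly_deg (g i))) (localizing_mat (g i) y)) \<and>
     (\<forall>i\<in>{1..l}. zero_on (multi_idx (r - poly_deg (h i))) (localizing_mat (h i) y)) \<and>
     y (0, 0) = 1"

text \<open>
  For self-conjugate \<open>f\<close> and a pseudo-moment sequence \<open>y\<close> the number \<open>L_fun y f\<close> is real,
  so \<open>Re\<close> below merely converts it.
\<close>

definition moment_relax ::
  "complex set \<Rightarrow> 'n::finite cpoly \<Rightarrow> nat \<Rightarrow> (nat \<Rightarrow> 'n cpoly) \<Rightarrow> nat \<Rightarrow> (nat \<Rightarrow> 'n cpoly) \<Rightarrow> nat
   \<Rightarrow> ereal" where
  "moment_relax K f m g l h r = Inf {ereal (Re (L_fun y f)) | y. moment_feasible K m g l h r y}"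

definition hsos_feasible ::
  "complex set \<Rightarrow> 'n::finite cpoly \<Rightarrow> nat \<Rightarrow> (nat \<Rightarrow> 'n cpoly) \<Rightarrow> nat \<Rightarrow> (nat \<Rightarrow> 'n cpoly) \<Rightarrow> nat
   \<Rightarrow> real \<Rightarrow> bool" where
  "hsos_feasible K f m g l h r c \<longleftrightarrow> (\<exists>\<sigma>0 \<sigma> \<tau>.
     \<sigma>0 \<in> hsos K r \<and>
     (\<forall>i\<in>{1..m}. \<sigma> i \<in> hsos K (r - poly_deg (g i))) \<and>
     (\<forall>i\<in>{1..l}. \<tau> i \<in> self_conj_polys K (r - poly_deg (h i))) \<and>
     f - Poly_Mapping.single 0 (complex_of_real c) =
       \<sigma>0 + (\<Sum>i=1..m. \<sigma> i * g i) + (\<Sum>i=1..l. \<tau> i * h i))"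

definition hsos_relax ::
  "complex set \<Rightarrow> 'n::finite cpoly \<Rightarrow> nat \<Rightarrow> (nat \<Rightarrow> 'n cpoly) \<Rightarrow> nat \<Rightarrow> (nat \<Rightarrow> 'n cpoly) \<Rightarrow> nat
   \<Rightarrow> ereal" where
  "hsos_relax K f m g l h r = Sup {ereal c | c. hsos_feasible K f m g l h r c}"

abbreviation "theta \<equiv> moment_relax UNIV"
abbreviation "eta \<equiv> moment_relax \<real>"
abbreviation "theta_hat \<equiv> hsos_relax UNIV"
abbreviation "eta_hat \<equiv> hsos_relax \<real>"

end

theory Submission imports Defs begin

text \<open>
  Taking the real part of every entry of a feasible pseudo-moment sequence, or of every coefficient
  of a feasible HSOS certificate, preserves feasibility and the objective value, because the data
  have real coefficients. For the moment matrices this holds since \<open>Re A\<close> is the average of the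
  positive semidefinite matrices \<open>A\<close> and \<open>cnj A\<close>. For the sums of squares, writing \<open>q = a + \<i> b\<close>
  with \<open>a\<close> and \<open>b\<close> having real coefficients, the coefficientwise real part of \<open>|q|\<^sup>2\<close>
  is \<open>|a|\<^sup>2 + |b|\<^sup>2\<close>.
\<close>

section \<open>Coefficientwise real and imaginary parts of polynomials\<close>

definition re_poly :: "('a \<Rightarrow>\<^sub>0 complex) \<Rightarrow> ('a \<Rightarrow>\<^sub>0 complex)" where
  "re_poly p = Poly_Mapping.map (\<lambda>x. complex_of_real (Re x)) p"

definition im_poly :: "('a \<Rightarrow>\<^sub>0 complex) \<Rightarrow> ('a \<Rightarrow>\<^sub>0 complex)" where
  "im_poly p = Poly_Mapping.map (\<lambda>x. complex_of_real (Im x)) p"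

lemma lookup_re_poly [simp]:
  "Poly_Mapping.lookup (re_poly p) k = complex_of_real (Re (Poly_Mapping.lookup p k))"
  by (simp add: re_poly_def Poly_Mapping.map.rep_eq when_def)

lemma lookup_im_poly [simp]:
  "Poly_Mapping.lookup (im_poly p) k = complex_of_real (Im (Poly_Mapping.lookup p k))"
  by (simp add: im_poly_def Poly_Mapping.map.rep_eq when_def)

lemma keys_re_poly: "Poly_Mapping.keys (re_poly p) \<subseteq> Poly_Mapping.keys p"
  by (auto simp: in_keys_iff)

lemma keys_im_poly: "Poly_Mapping.keys (im_poly p) \<subseteq> Poly_Mapping.keys p"
  by (auto simp: in_keys_iff)

lemma coeffs_in_Reals_iff: "coeffs_in \<real> p \<longleftrightarrow> (\<forall>k. Im (Poly_Mapping.lookup p k) = 0)"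
  by (simp only: coeffs_in_def complex_is_Real_iff)

lemma re_poly_add: "re_poly (p + q) = re_poly p + re_poly q"
  by (rule poly_mapping_eqI) (simp add: lookup_add)

lemma re_poly_sum: "re_poly (sum F A) = (\<Sum>i\<in>A. re_poly (F i))"
  by (rule poly_mapping_eqI) (simp add: lookup_sum)

lemma re_poly_eq_self: "coeffs_in \<real> p \<Longrightarrow> re_poly p = p"
  \<comment> \<open>Keys are pairs, so \<open>split_paired_All\<close> would turn the hypothesis
    into a rule for explicit pairs, which does not match the variable key of the goal.\<close>
  by (rule poly_mapping_eqI) (simp del: split_paired_All add: coeffs_in_Reals_iff complex_eq_iff)

lemma coeffs_in_re_poly: "coeffs_in \<real> (re_poly p)"
  by (simp add: coeffs_in_def)

lemma coeffs_in_im_poly: "coeffs_in \<real> (im_poly p)"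
  by (simp add: coeffs_in_def)

text \<open>The freedom in \<open>A\<close> and \<open>B\<close> serves to expand products of a
  polynomial and of its real or imaginary part over the same index sets, although the supports may
  shrink. Identities between such products can then be checked term by term.\<close>

lemma lookup_mult_superset:
  fixes p q :: "'a::monoid_add \<Rightarrow>\<^sub>0 'b::semiring_0"
  assumes "finite A" "Poly_Mapping.keys p \<subseteq> A" "finite B" "Poly_Mapping.keys q \<subseteq> B"
  shows "Poly_Mapping.lookup (p * q) k =
    (\<Sum>a\<in>A. \<Sum>b\<in>B. if a + b = k then Poly_Mapping.lookup p a * Poly_Mapping.lookup q b else 0)"
proof -
  have single_sum: "p = (\<Sum>a\<in>A. Poly_Mapping.single a (Poly_Mapping.lookup p a))"
    if "finite A" "Poly_Mapping.keys p \<subseteq> A" for A and p :: "'a \<Rightarrow>\<^sub>0 'b"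
    using that by (intro poly_mapping_eqI)
      (auto simp: lookup_sum lookup_single when_def sum.delta in_keys_iff)
  have "p * q = (\<Sum>a\<in>A. Poly_Mapping.single a (Poly_Mapping.lookup p a)) *
      (\<Sum>b\<in>B. Poly_Mapping.single b (Poly_Mapping.lookup q b))"
    using single_sum[OF assms(1,2)] single_sum[OF assms(3,4)] by simp
  then show ?thesis
    by (simp add: sum_product mult_single lookup_sum lookup_single when_def)
qed

lemma re_poly_mult_real:
  fixes p q :: "'n::finite cpoly"
  assumes "coeffs_in \<real> q"
  shows "re_poly (p * q) = re_poly p * q"
proof (rule poly_mapping_eqI)
  fix k
  \<comment> \<open>\<open>Re\<close> is only real-linear: a factor can be pulled out of it because
    the coefficients of \<open>q\<close> are real.\<close>
  have mult: "complex_of_real (Re (x * Poly_Mapping.lookup q b)) =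
      complex_of_real (Re x) * Poly_Mapping.lookup q b" for x b
    using assms by (simp del: split_paired_All add: coeffs_in_Reals_iff complex_eq_iff)
  let ?A = "Poly_Mapping.keys p" and ?B = "Poly_Mapping.keys q"
  have "Poly_Mapping.lookup (re_poly (p * q)) k = (\<Sum>a\<in>?A. \<Sum>b\<in>?B. complex_of_real (Re
      (if a + b = k then Poly_Mapping.lookup p a * Poly_Mapping.lookup q b else 0)))"
    by (simp add: lookup_mult_superset[of ?A p ?B q] del: times_complex.sel)
  also have "\<dots> = (\<Sum>a\<in>?A. \<Sum>b\<in>?B.
      if a + b = k then complex_of_real (Re (Poly_Mapping.lookup p a)) * Poly_Mapping.lookup q b else 0)"
    \<comment> \<open>\<open>Re\<close> of a product has to stay unexpanded for \<open>mult\<close>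
      to rewrite it.\<close>
    by (intro sum.cong refl) (simp add: mult del: times_complex.sel)
  also have "\<dots> = Poly_Mapping.lookup (re_poly p * q) k"
    using keys_re_poly[of p] by (simp add: lookup_mult_superset[of ?A "re_poly p" ?B q] cong: if_cong)
  finally show "Poly_Mapping.lookup (re_poly (p * q)) k = Poly_Mapping.lookup (re_poly p * q) k" .
qed

lemma self_conj_iff:
  "self_conj p \<longleftrightarrow> (\<forall>\<beta> \<gamma>. Poly_Mapping.lookup p (\<beta>, \<gamma>) = cnj (Poly_Mapping.lookup p (\<gamma>, \<beta>)))"
  unfolding self_conj_def
  by (metis (no_types, opaque_lifting) lookup_poly_conj poly_mapping_eqI prod.exhaust)

lemma keys_poly_conj: "Poly_Mapping.keys (poly_conj p) = prod.swap ` Poly_Mapping.keys p"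
  by (force simp: in_keys_iff lookup_poly_conj image_iff)

text \<open>Each coefficient of \<open>q * poly_conj q\<close> is a sum of terms
  \<open>x * cnj y\<close> with \<open>x\<close>, \<open>y\<close> coefficients of \<open>q\<close>,
  and \<open>Re (x * cnj y) = Re x * Re y + Im x * Im y\<close>. The mixed products of real and
  imaginary parts only enter the imaginary part.\<close>

lemma re_poly_mult_conj:
  fixes q :: "'n::finite cpoly"
  shows "re_poly (q * poly_conj q) = re_poly q * poly_conj (re_poly q) + im_poly q * poly_conj (im_poly q)"
proof (rule poly_mapping_eqI)
  fix k
  let ?A = "Poly_Mapping.keys q"
  have conj: "Poly_Mapping.lookup (poly_conj p) b = cnj (Poly_Mapping.lookup p (prod.swap b))"
    for p :: "'n cpoly" and b
    by (cases b) (simp add: lookup_poly_conj)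
  \<comment> \<open>Used for \<open>q\<close>, \<open>re_poly q\<close> and
    \<open>im_poly q\<close>: all three double sums run over the support of \<open>q\<close> and its
    swapped copy.\<close>
  have expand: "Poly_Mapping.lookup (p * poly_conj p) k = (\<Sum>a\<in>?A. \<Sum>b\<in>prod.swap ` ?A. if a + b = k
      then Poly_Mapping.lookup p a * cnj (Poly_Mapping.lookup p (prod.swap b)) else 0)"
    if "Poly_Mapping.keys p \<subseteq> ?A" for p :: "'n cpoly"
    using that by (subst lookup_mult_superset[of ?A p "prod.swap ` ?A"])
      (auto simp: keys_poly_conj conj intro!: sum.cong)
  show "Poly_Mapping.lookup (re_poly (q * poly_conj q)) k =
    Poly_Mapping.lookup (re_poly q * poly_conj (re_poly q) + im_poly q * poly_conj (im_poly q)) k"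
    by (simp only: lookup_add lookup_re_poly expand[OF order_refl]
          expand[OF keys_re_poly] expand[OF keys_im_poly])
      (auto simp flip: sum.distrib intro!: sum.cong)
qed

section \<open>Real parts of HSOS certificates\<close>

lemma re_poly_self_conj_polys:
  assumes "p \<in> self_conj_polys K s"
  shows "re_poly p \<in> self_conj_polys \<real> s"
proof -
  have "self_conj (re_poly p)"
    using assms unfolding self_conj_polys_def self_conj_iff
    by (metis (mono_tags, lifting) cnj.sel(1) complex_cnj_complex_of_real lookup_re_poly mem_Collect_eq)
  then show ?thesis
    \<comment> \<open>The degree bounds survive because taking real parts can only shrink the
      support.\<close>
    using assms keys_re_poly[of p] by (auto simp: self_conj_polys_def coeffs_in_re_poly)
qed

lemma re_poly_hsos:
  fixes p :: "'n::finite cpoly"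
  assumes "p \<in> hsos K s"
  shows "re_poly p \<in> hsos \<real> s"
proof -
  from assms obtain t :: nat and q where q: "\<forall>i\<in>{1..t}. q i \<in> holo_polys K"
    and p: "p = (\<Sum>i=1..t. q i * poly_conj (q i))" and sc: "p \<in> self_conj_polys K s"
    by (auto simp: hsos_def)
  \<comment> \<open>The \<open>t\<close> squares become \<open>2 * t\<close>: indices up to
    \<open>t\<close> carry the real parts, the indices from \<open>t + 1\<close> to
    \<open>t + t\<close> the imaginary parts.\<close>
  define Q where "Q i = (if i \<le> t then re_poly (q i) else im_poly (q (i - t)))" for i
  have "\<forall>i\<in>{1..t + t}. Q i \<in> holo_polys \<real>"
  proof
    fix i assume i: "i \<in> {1..t + t}"
    show "Q i \<in> holo_polys \<real>"
    proof (cases "i \<le> t")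
      case True
      then have "q i \<in> holo_polys K" using q i by auto
      then show ?thesis
        using True keys_re_poly[of "q i"] by (auto simp: Q_def holo_polys_def coeffs_in_re_poly)
    next
      case False
      then have "i - t \<in> {1..t}" using i by auto
      then have "q (i - t) \<in> holo_polys K" using q by blast
      then show ?thesis
        using False keys_im_poly[of "q (i - t)"]
        by (auto simp: Q_def holo_polys_def coeffs_in_im_poly)
    qed
  qed
  moreover have "re_poly p = (\<Sum>i=1..t + t. Q i * poly_conj (Q i))"
  proof -
    have "(\<Sum>i=1..t + t. Q i * poly_conj (Q i)) =
        (\<Sum>i=1..t. Q i * poly_conj (Q i)) + (\<Sum>i=1+t..t+t. Q i * poly_conj (Q i))"
      by (subst sum.ub_add_nat) (auto simp: add.commute)
    also have "(\<Sum>i=1+t..t+t. Q i * poly_conj (Q i)) =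
        (\<Sum>i=1..t. Q (i + t) * poly_conj (Q (i + t)))"
      by (rule sum.shift_bounds_cl_nat_ivl)
    also have "\<dots> = (\<Sum>i=1..t. im_poly (q i) * poly_conj (im_poly (q i)))"
      by (intro sum.cong) (auto simp: Q_def)
    also have "(\<Sum>i=1..t. Q i * poly_conj (Q i)) =
        (\<Sum>i=1..t. re_poly (q i) * poly_conj (re_poly (q i)))"
      by (intro sum.cong) (auto simp: Q_def)
    finally show ?thesis
      by (simp add: p re_poly_sum re_poly_mult_conj sum.distrib)
  qed
  ultimately show ?thesis
    using re_poly_self_conj_polys[OF sc] unfolding hsos_def by blast
qed

lemma hsos_mono: "K \<subseteq> K' \<Longrightarrow> hsos K s \<subseteq> hsos K' s"
  unfolding hsos_def self_conj_polys_def holo_polys_def coeffs_in_def by blast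

lemma self_conj_polys_mono: "K \<subseteq> K' \<Longrightarrow> self_conj_polys K s \<subseteq> self_conj_polys K' s"
  unfolding self_conj_polys_def coeffs_in_def by blast

lemma hsos_feasible_mono:
  assumes "K \<subseteq> K'" "hsos_feasible K f m g l h r c"
  shows "hsos_feasible K' f m g l h r c"
proof -
  from assms(2) obtain \<sigma>0 \<sigma> \<tau> where s: "\<sigma>0 \<in> hsos K r"
    "\<forall>i\<in>{1..m}. \<sigma> i \<in> hsos K (r - poly_deg (g i))"
    "\<forall>i\<in>{1..l}. \<tau> i \<in> self_conj_polys K (r - poly_deg (h i))"
    and eq: "f - Poly_Mapping.single 0 (complex_of_real c) =
       \<sigma>0 + (\<Sum>i=1..m. \<sigma> i * g i) + (\<Sum>i=1..l. \<tau> i * h i)"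
    unfolding hsos_feasible_def by blast
  show ?thesis
    unfolding hsos_feasible_def
  proof (intro exI conjI)
    show "\<sigma>0 \<in> hsos K' r" "\<forall>i\<in>{1..m}. \<sigma> i \<in> hsos K' (r - poly_deg (g i))"
      using s hsos_mono[OF assms(1)] by auto
    show "\<forall>i\<in>{1..l}. \<tau> i \<in> self_conj_polys K' (r - poly_deg (h i))"
      using s self_conj_polys_mono[OF assms(1)] by auto
  qed (rule eq)
qed

text \<open>Apply \<open>re_poly\<close> to both sides of the certificate. The left side is fixed,
  since \<open>f\<close> and \<open>c\<close> are real, and on the right \<open>re_poly\<close>
  passes through the real factors \<open>g i\<close> and \<open>h i\<close> to reach the
  multipliers.\<close>

lemma hsos_feasible_real:
  assumes feas: "hsos_feasible K f m g l h r c" and f: "coeffs_in \<real> f"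
    and g: "\<And>i. i \<in> {1..m} \<Longrightarrow> coeffs_in \<real> (g i)"
    and h: "\<And>i. i \<in> {1..l} \<Longrightarrow> coeffs_in \<real> (h i)"
  shows "hsos_feasible \<real> f m g l h r c"
proof -
  from feas obtain \<sigma>0 \<sigma> \<tau> where s: "\<sigma>0 \<in> hsos K r"
    "\<forall>i\<in>{1..m}. \<sigma> i \<in> hsos K (r - poly_deg (g i))"
    "\<forall>i\<in>{1..l}. \<tau> i \<in> self_conj_polys K (r - poly_deg (h i))"
    and eq: "f - Poly_Mapping.single 0 (complex_of_real c) =
       \<sigma>0 + (\<Sum>i=1..m. \<sigma> i * g i) + (\<Sum>i=1..l. \<tau> i * h i)"
    unfolding hsos_feasible_def by blast
  have "coeffs_in \<real> (f - Poly_Mapping.single 0 (complex_of_real c))"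
    using f by (auto simp: coeffs_in_def lookup_minus lookup_single when_def)
  then have "f - Poly_Mapping.single 0 (complex_of_real c) =
      re_poly (f - Poly_Mapping.single 0 (complex_of_real c))"
    by (simp add: re_poly_eq_self)
  also have "\<dots> = re_poly \<sigma>0 + (\<Sum>i=1..m. re_poly (\<sigma> i) * g i) + (\<Sum>i=1..l. re_poly (\<tau> i) * h i)"
    unfolding eq re_poly_add re_poly_sum
    by (intro arg_cong2[where f = "(+)"] sum.cong refl re_poly_mult_real g h)
  finally have "f - Poly_Mapping.single 0 (complex_of_real c) =
      re_poly \<sigma>0 + (\<Sum>i=1..m. re_poly (\<sigma> i) * g i) + (\<Sum>i=1..l. re_poly (\<tau> i) * h i)" .
  moreover have "re_poly \<sigma>0 \<in> hsos \<real> r"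
    "\<forall>i\<in>{1..m}. re_poly (\<sigma> i) \<in> hsos \<real> (r - poly_deg (g i))"
    "\<forall>i\<in>{1..l}. re_poly (\<tau> i) \<in> self_conj_polys \<real> (r - poly_deg (h i))"
    using s by (auto intro: re_poly_hsos re_poly_self_conj_polys)
  ultimately show ?thesis
    unfolding hsos_feasible_def by (intro exI conjI)
qed

section \<open>Real parts of pseudo-moment sequences\<close>

lemma psd_on_Re:
  assumes "psd_on I A"
  shows "psd_on I (\<lambda>\<beta> \<gamma>. complex_of_real (Re (A \<beta> \<gamma>)))"
  unfolding psd_on_def
proof (intro conjI ballI allI)
  fix \<beta> \<gamma> assume "\<beta> \<in> I" "\<gamma> \<in> I"
  then show "complex_of_real (Re (A \<beta> \<gamma>)) = cnj (complex_of_real (Re (A \<gamma> \<beta>)))"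
    using assms unfolding psd_on_def by (metis cnj.sel(1) complex_cnj_complex_of_real)
next
  fix x :: "'a \<Rightarrow> complex"
  define S where "S x = (\<Sum>\<beta>\<in>I. \<Sum>\<gamma>\<in>I. cnj (x \<beta>) * A \<beta> \<gamma> * x \<gamma>)" for x
  have "0 \<le> Re (S z)" for z
    using assms unfolding psd_on_def S_def by (rule conjunct2[THEN spec])
  \<comment> \<open>The value of \<open>S\<close> at the conjugate vector is the conjugate of the
    form of \<open>cnj A\<close> at \<open>x\<close>, so the two real parts add up to twice that of
    the form of \<open>Re A\<close> at \<open>x\<close>.\<close>
  then have "0 \<le> Re (S x) + Re (S (\<lambda>\<beta>. cnj (x \<beta>)))"
    by (intro add_nonneg_nonneg)
  also have "\<dots> = 2 * Re (\<Sum>\<beta>\<in>I. \<Sum>\<gamma>\<in>I. cnj (x \<beta>) * complex_of_real (Re (A \<beta> \<gamma>)) * x \<gamma>)"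
    by (simp add: S_def sum_distrib_left flip: sum.distrib) (simp add: algebra_simps)
  finally show "0 \<le> Re (\<Sum>\<beta>\<in>I. \<Sum>\<gamma>\<in>I. cnj (x \<beta>) * complex_of_real (Re (A \<beta> \<gamma>)) * x \<gamma>)"
    by simp
qed

text \<open>The entries are linear in \<open>y\<close> with the real coefficients of
  \<open>g\<close>. Hence positive semidefiniteness of a localizing matrix transfers by
  \<open>psd_on_Re\<close>, and its vanishing transfers entrywise.\<close>

lemma localizing_mat_Re:
  assumes "coeffs_in \<real> g"
  shows "localizing_mat g (\<lambda>k. complex_of_real (Re (y k))) =
    (\<lambda>\<beta> \<gamma>. complex_of_real (Re (localizing_mat g y \<beta> \<gamma>)))"
proof (intro ext)
  fix \<beta> \<gamma>
  have mult: "Poly_Mapping.lookup g k * complex_of_real (Re x) =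
      complex_of_real (Re (Poly_Mapping.lookup g k * x))" for k x
    using assms by (simp del: split_paired_All add: coeffs_in_Reals_iff complex_eq_iff)
  show "localizing_mat g (\<lambda>k. complex_of_real (Re (y k))) \<beta> \<gamma> =
      complex_of_real (Re (localizing_mat g y \<beta> \<gamma>))"
    by (simp only: localizing_mat_def mult Re_sum of_real_sum case_prod_unfold)
qed

lemma Re_L_fun_Re:
  assumes "coeffs_in \<real> f"
  shows "Re (L_fun (\<lambda>k. complex_of_real (Re (y k))) f) = Re (L_fun y f)"
  using assms by (simp del: split_paired_All add: L_fun_def coeffs_in_Reals_iff)

text \<open>The field \<open>K\<close> enters only through \<open>pseudo_moment\<close>:
  \<open>psd_on\<close> tests complex vectors in both relaxations.\<close>

lemma moment_feasible_mono:
  "K \<subseteq> K' \<Longrightarrow> moment_feasible K m g l h r y \<Longrightarrow> moment_feasible K' m g l h r y"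
  unfolding moment_feasible_def pseudo_moment_def by blast

lemma moment_feasible_real:
  assumes feas: "moment_feasible K m g l h r y"
    and g: "\<And>i. i \<in> {1..m} \<Longrightarrow> coeffs_in \<real> (g i)"
    and h: "\<And>i. i \<in> {1..l} \<Longrightarrow> coeffs_in \<real> (h i)"
  shows "moment_feasible \<real> m g l h r (\<lambda>k. complex_of_real (Re (y k)))"
proof -
  have "pseudo_moment \<real> (\<lambda>k. complex_of_real (Re (y k)))"
    using feas unfolding moment_feasible_def pseudo_moment_def
    by (metis Reals_of_real cnj.sel(1) complex_cnj_complex_of_real)
  moreover have "psd_on (multi_idx r) (moment_mat (\<lambda>k. complex_of_real (Re (y k))))"
    using feas psd_on_Re[of "multi_idx r" "moment_mat y"]
    by (simp add: moment_feasible_def moment_mat_def[abs_def])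
  ultimately show ?thesis
    using feas by (auto simp: moment_feasible_def localizing_mat_Re g h psd_on_Re zero_on_def)
qed

theorem theorem3p3:
  fixes f :: "'n::finite cpoly" and g h :: "nat \<Rightarrow> 'n cpoly" and m l r :: nat
  assumes "self_conj f" and "coeffs_in \<real> f"
    and "\<And>i. i \<in> {1..m} \<Longrightarrow> self_conj (g i) \<and> coeffs_in \<real> (g i)"
    and "\<And>i. i \<in> {1..l} \<Longrightarrow> self_conj (h i) \<and> coeffs_in \<real> (h i)"
    and "r \<ge> d_min f m g l h"
  shows "theta f m g l h r = eta f m g l h r \<and> theta_hat f m g l h r = eta_hat f m g l h r"
proof
  have g: "\<And>i. i \<in> {1..m} \<Longrightarrow> coeffs_in \<real> (g i)" and h: "\<And>i. i \<in> {1..l} \<Longrightarrow> coeffs_in \<real> (h i)"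
    using assms by auto
  have moment: "moment_feasible \<real> m g l h r (\<lambda>k. complex_of_real (Re (y k)))"
    if "moment_feasible UNIV m g l h r y" for y
    using that g h by (rule moment_feasible_real)
  \<comment> \<open>The sets of attained objective values coincide, so the infima agree also when
    the relaxation is infeasible or unbounded.\<close>
  have "{ereal (Re (L_fun y f)) | y. moment_feasible UNIV m g l h r y} =
      {ereal (Re (L_fun y f)) | y. moment_feasible \<real> m g l h r y}"
  proof (intro Collect_cong iffI; elim exE conjE)
    fix v y assume "v = ereal (Re (L_fun y f))" and y: "moment_feasible UNIV m g l h r y"
    then have "v = ereal (Re (L_fun (\<lambda>k. complex_of_real (Re (y k))) f))"
      by (simp add: Re_L_fun_Re[OF assms(2)])
    then show "\<exists>y. v = ereal (Re (L_fun y f)) \<and> moment_feasible \<real> m g l h r y"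
      using moment[OF y] by blast
  next
    fix v y assume "v = ereal (Re (L_fun y f))" "moment_feasible \<real> m g l h r y"
    then show "\<exists>y. v = ereal (Re (L_fun y f)) \<and> moment_feasible UNIV m g l h r y"
      using moment_feasible_mono[OF subset_UNIV] by blast
  qed
  then show "theta f m g l h r = eta f m g l h r"
    by (simp add: moment_relax_def)
  have "hsos_feasible \<real> f m g l h r c" if "hsos_feasible UNIV f m g l h r c" for c
    using that assms(2) g h by (rule hsos_feasible_real)
  \<comment> \<open>Likewise both HSOS relaxations admit exactly the same bounds
    \<open>c\<close>.\<close>
  then have "hsos_feasible UNIV f m g l h r = hsos_feasible \<real> f m g l h r"
    using hsos_feasible_mono[OF subset_UNIV[of \<real>]] by blast
  then show "theta_hat f m g l h r = eta_hat f m g l h r"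
    by (simp add: hsos_relax_def)
qed

end
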